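(* Let $n \geq 2$ and $k \geq 1$ be integers. Let $(N_i)_{i \geq 0}$ be the $n$-nacci sequence and let $S = \{N_n, N_{n+1}, \ldots, N_{n+k-1}\}$, a set of $k$ jars. Then $$\mathrm{CM}(S) = \left\lfloor \frac{(n-1)k}{n} \right\rfloor + 1.$$
   Context: A finite set $S$ of distinct positive integers is regarded as a set of jars, the jar corresponding to $s \in S$ initially containing $s$ cookies. On a move, the Cookie Monster chooses a subset of the jars and a positive integer $a$ and removes exactly $a$ cookies from each jar of the chosen subset (each chosen jar must contain at least $a$ cookies at that time). The Cookie Monster number $\mathrm{CM}(S)$ is the minimum number of moves needed to empty all of the jars. The $n$-nacci sequence is defined by $N_i = 0$ for $0 \leq i < n-1$, $N_{n-1} = N_n = 1$, and $N_i = N_{i-n} + N_{i-n+1} + \cdots + N_{i-1}$ for $i \geq n$. (For $n=2$ this is the Fibonacci sequence, for $n = 3$ the Tribonacci sequence.) *)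

theory Defs
  imports Complex_Main
begin

text \<open>
  A position of the Cookie Monster game is a function \<open>c\<close> giving, for each jar \<open>s\<close>, the current number
  of cookies in it. The jars are named by their initial contents, so the initial position is the
  identity.
\<close>

definition cm_move :: "nat set \<Rightarrow> (nat \<Rightarrow> nat) \<Rightarrow> (nat \<Rightarrow> nat) \<Rightarrow> bool" where
  "cm_move S c c' \<longleftrightarrow>
     (\<exists>A a. A \<subseteq> S \<and> a > 0 \<and> (\<forall>s\<in>A. a \<le> c s) \<and>
            c' = (\<lambda>s. if s \<in> A then c s - a else c s))"

definition cm_empties :: "nat set \<Rightarrow> nat \<Rightarrow> bool" where
  "cm_empties S m \<longleftrightarrow> (\<exists>c. (cm_move S ^^ m) (\<lambda>s. s) c \<and> (\<forall>s\<in>S. c s = 0))"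

definition CM :: "nat set \<Rightarrow> nat" where
  "CM S = (LEAST m. cm_empties S m)"

text \<open>The minimum is attained: a finite set of nonempty jars can be emptied one jar at a time.\<close>

lemma cm_empties_card:
  assumes "finite S" and "0 \<notin> S"
  shows "cm_empties S (card S)"
proof -
  have "(cm_move S ^^ card T) (\<lambda>s. s) (\<lambda>s. if s \<in> T then 0 else s)" if "T \<subseteq> S" for T
    using finite_subset[OF that assms(1)] that
  proof (induction T rule: finite_induct)
    case empty
    then show ?case by simp
  next
    case (insert x T)
    have "cm_move S (\<lambda>s. if s \<in> T then 0 else s) (\<lambda>s. if s \<in> insert x T then 0 else s)"
      unfolding cm_move_def
      by (rule exI[of _ "{x}"], rule exI[of _ x])
         (use insert assms(2) in \<open>auto simp: fun_eq_iff intro: gr0I\<close>)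
    with insert show ?case by auto
  qed
  from this[of S] show ?thesis
    unfolding cm_empties_def by fastforce
qed

lemma cm_empties_CM:
  assumes "finite S" and "0 \<notin> S"
  shows "cm_empties S (CM S)"
  unfolding CM_def using cm_empties_card[OF assms] by (rule LeastI)

fun nnacci :: "nat \<Rightarrow> nat \<Rightarrow> nat" where
  "nnacci n i =
     (if i + 1 < n then 0
      else if i + 1 = n \<or> i = n then 1
      else (\<Sum>j = i - n..<i. nnacci n j))"

declare nnacci.simps [simp del]

text \<open>The recurrence also holds at index \<open>n\<close>, where the value is given explicitly above.\<close>

lemma nnacci_rec:
  assumes "n \<ge> 1" and "i \<ge> n"
  shows "nnacci n i = (\<Sum>j = i - n..<i. nnacci n j)"
proof (cases "i = n")
  case True
  obtain m where m: "n = Suc m" using assms(1) by (cases n) auto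
  have "(\<Sum>j = 0..<m. nnacci n j) = 0"
    by (rule sum.neutral) (simp add: nnacci.simps m)
  then show ?thesis
    using True m nnacci.simps[of n n] nnacci.simps[of n m] by simp
next
  case False
  then show ?thesis using assms by (subst nnacci.simps) auto
qed

end

theory Submission
  imports Defs
begin

text \<open>
  A set \<open>S\<close> can be emptied in \<open>m\<close> moves iff every element of \<open>S\<close> is a subset sum of \<open>m\<close> fixed move
  sizes. Drop from the indices \<open>n, \<dots>, n + k - 1\<close> all multiples of \<open>n\<close> except \<open>n\<close> itself. The dropped
  terms are then exactly the sums of all smaller kept terms, so the kept terms suffice as move sizes;
  and the kept terms are superincreasing, so at least as many moves as kept terms are needed.
\<close>

section \<open>Moves as subset sums\<close>

text \<open>Number the moves of a play: \<open>a i\<close> is the size of move \<open>i\<close>, and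
  \<open>U s\<close> collects the moves that touch jar \<open>s\<close>.\<close>

lemma cm_moves_subset_sums:
  assumes "(cm_move S ^^ m) c c'"
  shows "\<exists>a :: nat \<Rightarrow> nat. \<exists>U. \<forall>s. U s \<subseteq> {..<m} \<and> c s = c' s + (\<Sum>i\<in>U s. a i)"
  using assms
proof (induction m arbitrary: c')
  case 0
  then show ?case by (auto intro!: exI[of _ "\<lambda>_. {}"])
next
  case (Suc m)
  from Suc.prems obtain d where d: "(cm_move S ^^ m) c d" "cm_move S d c'"
    by auto
  from Suc.IH[OF d(1)] obtain a :: "nat \<Rightarrow> nat" and U
    where U: "\<And>s. U s \<subseteq> {..<m}" "\<And>s. c s = d s + (\<Sum>i\<in>U s. a i)"
    by blast
  from d(2) obtain A b where A: "\<forall>s\<in>A. b \<le> d s" "c' = (\<lambda>s. if s \<in> A then d s - b else d s)"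
    unfolding cm_move_def by blast
  define V where "V s = (if s \<in> A then insert m (U s) else U s)" for s
  have "V s \<subseteq> {..<Suc m} \<and> c s = c' s + (\<Sum>i\<in>V s. (a(m := b)) i)" for s
  proof -
    have "finite (U s)" "m \<notin> U s"
      using U(1)[of s] finite_subset by auto
    moreover from this have "(\<Sum>i\<in>U s. (a(m := b)) i) = (\<Sum>i\<in>U s. a i)"
      by (intro sum.cong) auto
    ultimately show ?thesis
      using U(1)[of s] U(2)[of s] A by (auto simp: V_def)
  qed
  then show ?case by blast
qed

text \<open>Each \<open>x\<close> in \<open>M\<close> becomes one move: remove \<open>x\<close> from
  every jar whose chosen summands \<open>U s\<close> include \<open>x\<close>. The order of the
  moves does not matter.\<close>

lemma cm_empties_subset_sums:
  assumes "finite M" and "0 \<notin> M" and "\<And>s. s \<in> S \<Longrightarrow> U s \<subseteq> M \<and> \<Sum>(U s) = s"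
  shows "cm_empties S (card M)"
proof -
  \<comment> \<open>The position once the moves in \<open>T\<close> are made; jars outside
    \<open>S\<close> are never touched.\<close>
  define pos where "pos T s = (if s \<in> S then s - \<Sum>(U s \<inter> T) else s)" for T s
  have "(cm_move S ^^ card T) (\<lambda>s. s) (pos T)" if "T \<subseteq> M" for T
    using finite_subset[OF that assms(1)] that
  proof (induction T rule: finite_induct)
    case empty
    then show ?case by (simp add: pos_def fun_eq_iff)
  next
    case (insert x T)
    let ?A = "{s \<in> S. x \<in> U s}"
    \<comment> \<open>The second part says that jar \<open>s\<close> still holds at least
      \<open>x\<close>, so the move is legal and the truncated subtraction is exact.\<close>
    have *: "\<Sum>(U s \<inter> insert x T) = x + \<Sum>(U s \<inter> T) \<and> x + \<Sum>(U s \<inter> T) \<le> s" if "s \<in> ?A" for s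
    proof -
      have fin: "finite (U s)"
        using that assms(1,3) finite_subset by blast
      have "U s \<inter> insert x T = insert x (U s \<inter> T)" using that by auto
      then have "\<Sum>(U s \<inter> insert x T) = x + \<Sum>(U s \<inter> T)"
        using fin insert.hyps by simp
      moreover have "\<Sum>(U s \<inter> insert x T) \<le> \<Sum>(U s)"
        using fin by (intro sum_mono2) auto
      ultimately show ?thesis using assms(3)[of s] that by simp
    qed
    have "x > 0" using insert.prems assms(2) by (auto intro: gr0I)
    moreover have "\<forall>s\<in>?A. x \<le> pos T s" using * by (fastforce simp: pos_def)
    moreover have "pos (insert x T) = (\<lambda>s. if s \<in> ?A then pos T s - x else pos T s)"
      using * by (auto simp: pos_def fun_eq_iff)
    ultimately have "cm_move S (pos T) (pos (insert x T))"
      unfolding cm_move_def by (intro exI[of _ ?A] exI[of _ x] conjI) auto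
    with insert show ?case by auto
  qed
  from this[of M] have "(cm_move S ^^ card M) (\<lambda>s. s) (pos M)" by simp
  moreover have "pos M s = 0" if "s \<in> S" for s
    using assms(3)[OF that] that by (simp add: pos_def Int_absorb2)
  ultimately show ?thesis
    unfolding cm_empties_def by blast
qed

section \<open>Lower bound from superincreasing values\<close>

lemma sum_UN_le:
  fixes a :: "'j \<Rightarrow> nat"
  assumes "finite I" and "\<And>t. t \<in> I \<Longrightarrow> finite (U t)"
  shows "sum a (\<Union>t\<in>I. U t) \<le> (\<Sum>t\<in>I. sum a (U t))"
  using assms
proof (induction I rule: finite_induct)
  case empty
  then show ?case by simp
next
  case (insert t I)
  then have "sum a (U t \<union> (\<Union>t\<in>I. U t)) \<le> sum a (U t) + sum a (\<Union>t\<in>I. U t)"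
    by (subst sum_Un_nat) auto
  with insert show ?case by fastforce
qed

text \<open>
  The largest value exceeds the sum of the others, so some summand in its representation is not used
  for any other value; removing both gives the induction step.
\<close>

lemma superincreasing_card_le:
  fixes v :: "'i::linorder \<Rightarrow> nat" and a :: "'j \<Rightarrow> nat"
  assumes "finite I" and "finite J"
    and "\<And>t. t \<in> I \<Longrightarrow> (\<Sum>x | x \<in> I \<and> x < t. v x) < v t"
    and "\<And>t. t \<in> I \<Longrightarrow> U t \<subseteq> J \<and> v t = (\<Sum>i\<in>U t. a i)"
  shows "card I \<le> card J"
  using assms
proof (induction I arbitrary: J rule: finite_linorder_max_induct)
  case empty
  then show ?case by simp
next
  case (insert b I)
  have below: "{x. x \<in> insert b I \<and> x < t} = {x. x \<in> I \<and> x < t}" if "t \<in> I" for t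
    using insert.hyps that by auto
  have "{x. x \<in> insert b I \<and> x < b} = I"
    using insert.hyps by auto
  then have vb: "sum v I < v b" using insert.prems(2)[of b] by simp
  have finU: "finite (U t)" if "t \<in> insert b I" for t
    using insert.prems(1,3) that finite_subset by metis
  have "\<not> U b \<subseteq> (\<Union>t\<in>I. U t)"
  proof
    assume "U b \<subseteq> (\<Union>t\<in>I. U t)"
    then have "v b \<le> (\<Sum>i\<in>(\<Union>t\<in>I. U t). a i)"
      using insert.prems(3)[of b] finU insert.hyps(1) by (auto intro!: sum_mono2)
    also have "\<dots> \<le> (\<Sum>t\<in>I. \<Sum>i\<in>U t. a i)"
      by (rule sum_UN_le) (use finU insert.hyps(1) in auto)
    also have "\<dots> = sum v I"
      using insert.prems(3) by (intro sum.cong) auto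
    finally show False using vb by simp
  qed
  then obtain i where i: "i \<in> U b" "\<And>t. t \<in> I \<Longrightarrow> i \<notin> U t" by blast
  have "card I \<le> card (J - {i})"
    by (rule insert.IH) (use insert.prems i below in \<open>auto, metis\<close>)
  moreover have "i \<in> J" using i insert.prems(3)[of b] by blast
  moreover have "b \<notin> I" using insert.hyps(2) by blast
  ultimately show ?case
    using insert.hyps(1) insert.prems(1) card_Suc_Diff1[of J i] by simp
qed

section \<open>The n-nacci sequence\<close>

lemma nnacci_pos:
  assumes "n \<ge> 1" and "i + 1 \<ge> n"
  shows "nnacci n i > 0"
  using assms(2)
proof (induction i rule: less_induct)
  case (less i)
  show ?case
  proof (cases "i + 1 = n \<or> i = n")
    case True
    then show ?thesis using less.prems by (subst nnacci.simps) auto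
  next
    case False
    with less.prems assms have "nnacci n (i - 1) > 0" "i - 1 \<in> {i - n..<i}" "i \<ge> n"
      by (auto intro!: less.IH)
    then show ?thesis
      using nnacci_rec[OF assms(1), of i] member_le_sum[of "i - 1" "{i - n..<i}" "nnacci n"] by simp
  qed
qed

text \<open>Fewer than \<open>n\<close> terms are summed, so the recurrence for index
  \<open>i\<close> has the further summand at \<open>j - 1\<close>, which is positive even when
  \<open>j = n\<close>.\<close>

lemma sum_last_nnacci_less:
  assumes "n \<ge> 1" and "n \<le> j" and "i < j + n" and "j \<le> i"
  shows "(\<Sum>x = j..<i. nnacci n x) < nnacci n i"
proof -
  have "(\<Sum>x = j..<i. nnacci n x) < (\<Sum>x = i - n..<i. nnacci n x)"
    by (rule sum_strict_mono2[where b = "j - 1"]) (use assms nnacci_pos[of n "j - 1"] in auto)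
  then show ?thesis using nnacci_rec[of n i] assms by simp
qed

text \<open>From index \<open>n\<close> on the sequence increases strictly, because for
  \<open>n \<ge> 2\<close> a block of one term is short enough for
  \<open>sum_last_nnacci_less\<close>.\<close>

lemma inj_on_nnacci:
  assumes "n \<ge> 2"
  shows "inj_on (nnacci n) {n..}"
proof -
  have step: "nnacci n i < nnacci n (Suc i)" if "i \<ge> n" for i
    using sum_last_nnacci_less[of n i "Suc i"] assms that by simp
  have "nnacci n i < nnacci n j" if "i \<ge> n" "i < j" for i j
    by (rule lift_Suc_mono_less_ivl[where N = "{n..}"]) (use step that in auto)
  then show ?thesis
    by (intro linorder_inj_onI) (auto simp: less_imp_neq)
qed

section \<open>Kept indices and block sums\<close>

definition kept :: "nat \<Rightarrow> nat set" where
  "kept n = {i. i = n \<or> n < i \<and> \<not> n dvd i}"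

lemma kept_ge: "i \<in> kept n \<Longrightarrow> n \<le> i"
  by (auto simp: kept_def)

text \<open>No multiple of \<open>n\<close> lies strictly between \<open>j\<close> and
  \<open>i\<close>, so all indices there are kept. The kept terms up to \<open>j\<close> collapse to
  the single term at \<open>j\<close>: either \<open>j = n\<close> is the first kept index, or
  \<open>j\<close> is dropped and the previous full block sums to it by the recurrence.\<close>

lemma sum_kept_block:
  assumes "n \<ge> 1" and "n dvd j" and "n \<le> j" and "j < i" and "i \<le> j + n"
  shows "(\<Sum>x | x \<in> kept n \<and> x < i. nnacci n x) = (\<Sum>x = j..<i. nnacci n x)"
  using assms(2-)
proof (induction j arbitrary: i rule: less_induct)
  case (less j)
  have not_dvd: "\<not> n dvd x" if "j < x" "x < i" for x
  proof
    assume "n dvd x"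
    then have "n dvd x - j" using less.prems(1) by simp
    then show False using that less.prems(4) dvd_imp_le[of n "x - j"] by simp
  qed
  then have eq: "{x. x \<in> kept n \<and> x < i} = {x. x \<in> kept n \<and> x < Suc j} \<union> {Suc j..<i}"
    using less.prems by (auto simp: kept_def)
  have "(\<Sum>x | x \<in> kept n \<and> x < i. nnacci n x)
      = (\<Sum>x | x \<in> kept n \<and> x < Suc j. nnacci n x) + (\<Sum>x = Suc j..<i. nnacci n x)"
    unfolding eq by (rule sum.union_disjoint) auto
  also have "(\<Sum>x | x \<in> kept n \<and> x < Suc j. nnacci n x) = nnacci n j"
  proof (cases "j = n")
    case True
    then have "{x. x \<in> kept n \<and> x < Suc j} = {j}" by (auto simp: kept_def)
    then show ?thesis by simp
  next
    case False
    obtain q where q: "j = n * q" using less.prems(1) by blast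
    \<comment> \<open>This makes \<open>j - n\<close> at least \<open>n\<close>, so the induction
      hypothesis covers the block from \<open>j - n\<close> up to \<open>j\<close>.\<close>
    with False less.prems assms(1) have "q \<ge> 2" by (cases q; cases "q - 1") auto
    then have "n * 2 \<le> j" using q by simp
    moreover have "{x. x \<in> kept n \<and> x < Suc j} = {x. x \<in> kept n \<and> x < j}"
      using False less.prems(1) by (auto simp: kept_def less_Suc_eq)
    ultimately show ?thesis
      using less.IH[of "j - n" j] less.prems(1) assms(1) nnacci_rec[of n j] by simp
  qed
  also have "nnacci n j + (\<Sum>x = Suc j..<i. nnacci n x) = (\<Sum>x = j..<i. nnacci n x)"
    using less.prems by (simp add: sum.atLeast_Suc_lessThan)
  finally show ?case .
qed

lemma nnacci_skipped:
  assumes "n \<ge> 1" and "n \<le> i" and "i \<notin> kept n"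
  shows "(\<Sum>x | x \<in> kept n \<and> x < i. nnacci n x) = nnacci n i"
proof -
  have i: "n dvd i" "n < i" using assms by (auto simp: kept_def)
  then have "n dvd i - n" by simp
  moreover from this i have "n \<le> i - n" by (auto intro: dvd_imp_le)
  ultimately show ?thesis
    using sum_kept_block[of n "i - n" i] nnacci_rec[of n i] assms i by simp
qed

lemma nnacci_kept_superincreasing:
  assumes "n \<ge> 1" and "i \<in> kept n"
  shows "(\<Sum>x | x \<in> kept n \<and> x < i. nnacci n x) < nnacci n i"
proof (cases "i = n")
  case True
  then have "{x. x \<in> kept n \<and> x < i} = {}" by (auto simp: kept_def)
  then show ?thesis using nnacci_pos[of n i] True assms(1) by (simp only: sum.empty)
next
  case False
  then have i: "n < i" "\<not> n dvd i" using assms by (auto simp: kept_def)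
  \<comment> \<open>The last multiple of \<open>n\<close> before \<open>i\<close>; the block from
    \<open>j\<close> to \<open>i\<close> has fewer than \<open>n\<close> terms, hence the strict
    inequality.\<close>
  define j where "j = i div n * n"
  have "n dvd j" by (simp add: j_def)
  moreover from this i have "j \<noteq> i" by auto
  moreover have "j \<le> i" by (simp add: j_def)
  moreover have "i < j + n"
    using assms(1) by (simp add: j_def dividend_less_div_times add.commute)
  moreover have "n \<le> j"
    using i assms(1) div_greater_zero_iff[of i n] by (simp add: j_def)
  ultimately show ?thesis
    using sum_kept_block[of n j i] sum_last_nnacci_less[of n j i] assms(1) by simp
qed

section \<open>Counting the kept indices\<close>

lemma card_kept:
  assumes "n \<ge> 1" and "k \<ge> 1"
  shows "card (kept n \<inter> {..n + k - 1}) = k - (k - 1) div n"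
proof -
  \<comment> \<open>The dropped indices. The range starts at \<open>q = 1\<close> because
    \<open>n\<close> itself is kept: no smaller kept term could build its value.\<close>
  let ?D = "(\<lambda>q. n + n * q) ` {1..(k - 1) div n}"
  have le: "n * q \<le> k - 1 \<longleftrightarrow> q \<le> (k - 1) div n" for q
    using assms(1) by (simp add: less_eq_div_iff_mult_less_eq mult.commute)
  have "kept n \<inter> {..n + k - 1} = {n..n + k - 1} - ?D"
  proof (intro set_eqI iffI)
    fix i assume "i \<in> kept n \<inter> {..n + k - 1}"
    then show "i \<in> {n..n + k - 1} - ?D"
      using assms by (auto simp: kept_def)
  next
    fix i assume i: "i \<in> {n..n + k - 1} - ?D"
    have *: False if dvd: "n dvd i" "n < i"
    proof -
      obtain q where q: "i - n = n * q" using dvd by (metis dvd_def dvd_diff_nat dvd_refl)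
      with dvd have "q \<ge> 1" "i = n + n * q" by (auto simp: Suc_le_eq intro: gr0I)
      moreover have "n * q \<le> k - 1" using q i assms by auto
      ultimately show False using i le[of q] by auto
    qed
    show "i \<in> kept n \<inter> {..n + k - 1}"
      using i * by (auto simp: kept_def le_neq_implies_less)
  qed
  moreover have "?D \<subseteq> {n..n + k - 1}"
  proof (rule image_subsetI)
    fix q assume "q \<in> {1..(k - 1) div n}"
    then have "n * q \<le> k - 1" by (simp only: le atLeastAtMost_iff)
    then show "n + n * q \<in> {n..n + k - 1}" using assms(2) by simp
  qed
  moreover have "card ?D = (k - 1) div n"
    using assms(1) by (subst card_image) (auto simp: inj_on_def)
  ultimately show ?thesis using assms by (simp add: card_Diff_subset)
qed

text \<open>Writing \<open>k - 1 = n * q + r\<close> with \<open>r < n\<close> gives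
  \<open>(n - 1) * k = n * (k - 1 - q) + (n - 1 - r)\<close>, whose last summand is a remainder
  modulo \<open>n\<close>.\<close>

lemma floor_pred_mult_divide:
  fixes n k :: nat
  assumes "n \<ge> 1" and "k \<ge> 1"
  shows "\<lfloor>(real n - 1) * real k / real n\<rfloor> + 1 = int (k - (k - 1) div n)"
proof -
  define q r where "q = int ((k - 1) div n)" and "r = int ((k - 1) mod n)"
  have k: "int k = int n * q + r + 1"
    using assms by (simp add: q_def r_def flip: of_nat_mult of_nat_add)
  have r: "0 \<le> r" "r < int n" using assms by (auto simp: r_def)
  have "(real n - 1) * real k / real n = of_int ((int n - 1) * int k) / of_int (int n)"
    by simp
  then have "\<lfloor>(real n - 1) * real k / real n\<rfloor> = (int n - 1) * int k div int n"
    by (simp only: floor_divide_of_int_eq)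
  also have "(int n - 1) * int k = (int n - 1 - r) + int n * (int k - 1 - q)"
    unfolding k by (simp add: algebra_simps)
  also have "\<dots> div int n = int k - 1 - q"
    using r assms by simp
  finally show ?thesis
    using order_trans[OF div_le_dividend[of "k - 1" n] diff_le_self[of k 1]]
    by (simp add: q_def of_nat_diff)
qed

theorem theorem13:
  fixes n k :: nat
  assumes "n \<ge> 2" and "k \<ge> 1"
  shows "int (CM (nnacci n ` {n..n + k - 1})) = \<lfloor>(real n - 1) * real k / real n\<rfloor> + 1"
proof -
  have n: "n \<ge> 1" using assms(1) by simp
  let ?S = "nnacci n ` {n..n + k - 1}"
  let ?I = "kept n \<inter> {..n + k - 1}"
  \<comment> \<open>Cutting \<open>kept n\<close> off at the last jar changes nothing below
    \<open>i\<close>, so the facts about \<open>kept n\<close> carry over to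
    \<open>?I\<close>.\<close>
  have below: "{x. x \<in> ?I \<and> x < i} = {x. x \<in> kept n \<and> x < i}" if "i \<le> n + k - 1" for i
    using that by auto
  have inj: "inj_on (nnacci n) A" if "A \<subseteq> kept n" for A
    using inj_on_subset[OF inj_on_nnacci[OF assms(1)]] that kept_ge by blast
  have pos: "0 \<notin> nnacci n ` A" if "A \<subseteq> {n..}" for A
  proof
    assume "0 \<in> nnacci n ` A"
    then obtain i where "i \<in> A" "nnacci n i = 0" by auto
    then show False using nnacci_pos[OF n, of i] that by auto
  qed

  \<comment> \<open>Upper bound: a kept jar is emptied by its own move, a dropped one by the moves
    of all smaller kept terms.\<close>
  have "\<exists>U. U \<subseteq> nnacci n ` ?I \<and> \<Sum>U = s" if s: "s \<in> ?S" for s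
  proof -
    from s obtain i where i: "s = nnacci n i" "n \<le> i" "i \<le> n + k - 1" by auto
    show ?thesis
    proof (cases "i \<in> kept n")
      case True
      then show ?thesis using i by (intro exI[of _ "{s}"]) auto
    next
      case False
      let ?B = "{x. x \<in> kept n \<and> x < i}"
      have "\<Sum>(nnacci n ` ?B) = s"
        using nnacci_skipped[OF n i(2) False] inj[of ?B] i(1) by (simp add: sum.reindex)
      then show ?thesis using i(3) by (intro exI[of _ "nnacci n ` ?B"]) auto
    qed
  qed
  then obtain U where U: "\<And>s. s \<in> ?S \<Longrightarrow> U s \<subseteq> nnacci n ` ?I \<and> \<Sum>(U s) = s"
    by metis
  have "cm_empties ?S (card (nnacci n ` ?I))"
    by (rule cm_empties_subset_sums[where U = U]) (use pos kept_ge U in auto)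
  then have "cm_empties ?S (card ?I)"
    using inj[of ?I] by (simp add: card_image)
  then have upper: "CM ?S \<le> card ?I"
    unfolding CM_def by (rule Least_le)

  \<comment> \<open>Lower bound: the moves of an optimal play represent every kept value as a subset
    sum, since its jar ends empty.\<close>
  have "cm_empties ?S (CM ?S)"
    by (rule cm_empties_CM) (use pos in auto)
  then obtain c where c: "(cm_move ?S ^^ CM ?S) (\<lambda>s. s) c" "\<forall>s\<in>?S. c s = 0"
    unfolding cm_empties_def by blast
  obtain a :: "nat \<Rightarrow> nat" and V where V: "\<And>s. V s \<subseteq> {..<CM ?S}" "\<And>s. s = c s + (\<Sum>i\<in>V s. a i)"
    using cm_moves_subset_sums[OF c(1)] by blast
  have "card ?I \<le> card {..<CM ?S}"
  proof (rule superincreasing_card_le[where v = "nnacci n" and a = a and U = "\<lambda>i. V (nnacci n i)"])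
    fix i assume i: "i \<in> ?I"
    then show "(\<Sum>x | x \<in> ?I \<and> x < i. nnacci n x) < nnacci n i"
      using nnacci_kept_superincreasing[OF n] below by auto
    have "c (nnacci n i) = 0" using c(2) i kept_ge by auto
    then show "V (nnacci n i) \<subseteq> {..<CM ?S} \<and> nnacci n i = (\<Sum>j\<in>V (nnacci n i). a j)"
      using V by (metis add_0)
  qed auto
  with upper have "CM ?S = card ?I" by simp
  then show ?thesis
    using card_kept[OF n assms(2)] floor_pred_mult_divide[OF n assms(2)] by simp
qed

end
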